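(* Let $f:\mathbb{S}^n\to\mathbb{R}$, let $X_\star=R_\star R_\star^\top$ with $R_\star\in\mathbb{R}^{n\times r_\star}$ of full column rank be the unique minimizer of $f(X)$ subject to $\mathcal{A}(X)=b$, $X\succeq0$, and suppose there are $\alpha_f>0$ and $\varepsilon>0$ such that $$f(X)\ge f(X_\star)+\frac{\alpha_f}{2}\|X-X_\star\|_F^2$$ for all $X\succeq0$ with $\mathcal{A}(X)=b$, $\mathrm{rank}(X)\le r_\star$ and $\|X-X_\star\|_F\le\varepsilon$. Then for all $R\in\mathbb{R}^{n\times r_\star}$ such that $\mathcal{A}(RR^\top)=b$, the function $\varphi_f(R)=f(RR^\top)$ satisfies $$\varphi_f(R)\ge\varphi_f(R_\star)+\frac{\alpha_{\varphi_f}}{2}\mathrm{dist}(R,S)^2,\qquad \alpha_{\varphi_f}=2(\sqrt2-1)\,\sigma_{r_\star}^2(R_\star)\,\alpha_f,$$ where $S=\{R\in\mathbb{R}^{n\times r_\star}:RR^\top=X_\star\}$.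
   Context: $\mathbb{S}^n$ is the space of symmetric $n\times n$ matrices; $f$ is smooth and convex. $\mathcal{A}:\mathbb{S}^n\to\mathbb{R}^k$, $[\mathcal{A}(X)]_i=\langle A_i,X\rangle$ with $A_i\in\mathbb{S}^n$; $b\in\mathbb{R}^k$. $\|\cdot\|_F$ is the Frobenius norm and $\sigma_i(\cdot)$ is the $i$-th largest singular value. $\mathrm{dist}(R,S)=\min_{R'\in S}\|R-R'\|_F=\min_{\Omega\in\mathbb{R}^{r_\star\times r_\star},\,\Omega^\top\Omega=I}\|R-R_\star\Omega\|_F$.
   Formalization: The conclusion is stated only for feasible R that also satisfy ‖RRᵀ − X⋆‖_F ≤ ε, the neighbourhood where growth is assumed; for all feasible R it is false (e.g. n = r⋆ = 1, A = 0, f(x) = √(1+(x−100)²) − 1, R⋆ = 10, ε = 1, R = 0). *)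

theory Defs
  imports "HOL-Analysis.Analysis" "HOL-Library.Multiset"
begin

text \<open>
  An \<open>n \<times> m\<close> real matrix is an element of \<^typ>\<open>real ^ 'm ^ 'n\<close>.  On this type the library's
  inner product is the trace inner product and its norm is the Frobenius norm;
  \<open>infdist R S\<close> is therefore the Frobenius distance from \<open>R\<close> to a nonempty set \<open>S\<close>.
\<close>

lemma inner_matrix_eq_trace:
  fixes A B :: "real ^ 'm ^ 'n"
  shows "A \<bullet> B = trace (transpose A ** B)"
  unfolding trace_def inner_vec_def matrix_matrix_mult_def transpose_def
  by (simp add: sum.swap[of _ "UNIV :: 'm set"])

lemma norm_matrix_eq_Frobenius:
  fixes A :: "real ^ 'm ^ 'n"
  shows "norm A = sqrt (\<Sum>i\<in>UNIV. \<Sum>j\<in>UNIV. (A $ i $ j)\<^sup>2)"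
  by (simp add: norm_vec_def L2_set_def sum_nonneg)

definition sym_mats :: "(real ^ 'n ^ 'n) set" where
  "sym_mats = {X. transpose X = X}"

definition psd :: "real ^ 'n ^ 'n \<Rightarrow> bool" where
  "psd X \<longleftrightarrow> X \<in> sym_mats \<and> (\<forall>v. 0 \<le> v \<bullet> (X *v v))"

definition lin_meas :: "('k \<Rightarrow> real ^ 'n ^ 'n) \<Rightarrow> real ^ 'n ^ 'n \<Rightarrow> real ^ 'k" where
  "lin_meas A X = (\<chi> i. A i \<bullet> X)"

text \<open>
  Continuous differentiability of a function on the space of symmetric matrices: \<open>G\<close> is the
  gradient, and the derivative is taken within the subspace, so that the values of \<open>f\<close>
  at nonsymmetric matrices are irrelevant.
\<close>

definition smooth_on_sym :: "(real ^ 'n ^ 'n \<Rightarrow> real) \<Rightarrow> bool" where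
  "smooth_on_sym f \<longleftrightarrow>
     (\<exists>G. continuous_on sym_mats G \<and>
          (\<forall>X\<in>sym_mats. (f has_derivative (\<lambda>H. G X \<bullet> H)) (at X within sym_mats)))"

definition unique_minimizer :: "('a \<Rightarrow> real) \<Rightarrow> ('a \<Rightarrow> bool) \<Rightarrow> 'a \<Rightarrow> bool" where
  "unique_minimizer f P x \<longleftrightarrow> (\<forall>y. is_arg_min f P y \<longleftrightarrow> y = x)"

definition eigenspace :: "real ^ 'm ^ 'm \<Rightarrow> real \<Rightarrow> (real ^ 'm) set" where
  "eigenspace B \<mu> = {v. B *v v = \<mu> *\<^sub>R v}"

text \<open>
  The singular values of an \<open>n \<times> m\<close> matrix \<open>M\<close> are the square roots of the eigenvalues of
  \<open>M\<^sup>T M\<close>, repeated according to their multiplicity.  As \<open>M\<^sup>T M\<close> is symmetric, the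
  multiplicity is the dimension of the eigenspace, and there are \<open>m\<close> singular values in total.
\<close>

definition singular_values :: "real ^ 'm ^ 'n \<Rightarrow> real multiset" where
  "singular_values M =
     (\<Sum>\<mu> \<in> {\<mu>. \<exists>v. v \<noteq> 0 \<and> v \<in> eigenspace (transpose M ** M) \<mu>}.
        replicate_mset (dim (eigenspace (transpose M ** M) \<mu>)) (sqrt \<mu>))"

text \<open>The \<open>i\<close>-th largest singular value, counted from \<open>i = 1\<close>.\<close>

definition sing_val :: "nat \<Rightarrow> real ^ 'm ^ 'n \<Rightarrow> real" where
  "sing_val i M = rev (sorted_list_of_multiset (singular_values M)) ! (i - 1)"

definition factor_obj :: "(real ^ 'n ^ 'n \<Rightarrow> real) \<Rightarrow> real ^ 'r ^ 'n \<Rightarrow> real" where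
  "factor_obj f R = f (R ** transpose R)"

definition sol_set :: "real ^ 'n ^ 'n \<Rightarrow> (real ^ 'r ^ 'n) set" where
  "sol_set X = {R. R ** transpose R = X}"

end

theory Submission
  imports Defs
begin

text \<open>
  At a feasible factor \<open>R\<close> the growth condition applies to \<open>X = R R\<^sup>T\<close>, which is positive
  semidefinite of rank at most \<open>r\<close>.  So everything reduces to a statement about matrices
  alone, in which neither \<open>f\<close> nor the constraints appear
  (\<open>sing_val_infdist_sol_set_le\<close>): if \<open>\<sigma>\<close> is the least singular value of \<open>R\<^sub>0\<close>, then
  the squared distance from \<open>R\<close> to the factors of \<open>R\<^sub>0 R\<^sub>0\<^sup>T\<close>, multiplied by
  \<open>2 (sqrt 2 - 1) \<sigma>\<^sup>2\<close>, is at most the squared norm of \<open>R R\<^sup>T - R\<^sub>0 R\<^sub>0\<^sup>T\<close>.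

  To prove it, measure the distance from \<open>R\<close> to the factor \<open>U = R\<^sub>0 Q\<close> for which the
  orthogonal matrix \<open>Q\<close> maximizes the inner product of \<open>R\<^sub>0 Q\<close> and \<open>R\<close> (the orthogonal
  Procrustes problem).  Maximality makes \<open>N = U\<^sup>T R\<close> symmetric and positive semidefinite
  (\<open>exists_orthogonal_alignment\<close>).  Put \<open>H = R - U\<close>, \<open>P = H\<^sup>T H\<close>, \<open>G = U\<^sup>T U\<close> and
  \<open>D = U\<^sup>T H = N - G\<close>; then \<open>D\<close> is symmetric as well.  Expanding
  \<open>R R\<^sup>T - U U\<^sup>T = U H\<^sup>T + H U\<^sup>T + H H\<^sup>T\<close> and completing the square gives
  \<open>norm (R R\<^sup>T - U U\<^sup>T)\<^sup>2 =
     norm (P + sqrt 2 D)\<^sup>2 + (4 - 2 sqrt 2) (P \<bullet> N) + 2 (sqrt 2 - 1) (P \<bullet> G)\<close>.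
  The second term is nonnegative because \<open>P\<close> and \<open>N\<close> are positive semidefinite, and
  \<open>P \<bullet> G\<close> is the sum of \<open>norm (U h)\<^sup>2\<close> over the rows \<open>h\<close> of \<open>H\<close>, hence at least
  \<open>\<sigma>\<^sup>2 norm H\<^sup>2\<close> (\<open>factor_difference_lower_bound\<close>).

  That \<open>\<sigma>\<close> bounds \<open>norm (R\<^sub>0 x) / norm x\<close> from below needs the spectral theorem:
  the \<open>r\<close>-th entry of the list of singular values is its last one only if the dimensions
  of the eigenspaces of \<open>R\<^sub>0\<^sup>T R\<^sub>0\<close> add up to \<open>r\<close> (\<open>sum_dim_eigenspaces\<close>).
\<close>

section \<open>Trace inner products of matrix products\<close>

lemma inner_mult_left:
  fixes A :: "real ^ 'm ^ 'n" and B :: "real ^ 'l ^ 'm" and C :: "real ^ 'l ^ 'n"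
  shows "(A ** B) \<bullet> C = B \<bullet> (transpose A ** C)"
  by (simp add: inner_matrix_eq_trace matrix_transpose_mul matrix_mul_assoc)

lemma inner_transpose_transpose:
  fixes A B :: "real ^ 'm ^ 'n"
  shows "transpose A \<bullet> transpose B = A \<bullet> B"
  unfolding inner_vec_def transpose_def by simp (rule sum.swap)

lemma inner_mult_right:
  fixes A :: "real ^ 'm ^ 'n" and B :: "real ^ 'l ^ 'm" and C :: "real ^ 'l ^ 'n"
  shows "(A ** B) \<bullet> C = A \<bullet> (C ** transpose B)"
proof -
  have "(A ** B) \<bullet> C = (transpose B ** transpose A) \<bullet> transpose C"
    by (simp only: inner_transpose_transpose flip: matrix_transpose_mul)
  also have "\<dots> = transpose A \<bullet> transpose (C ** transpose B)"
    by (simp only: inner_mult_left matrix_transpose_mul transpose_transpose)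
  finally show ?thesis
    by (simp only: inner_transpose_transpose)
qed

text \<open>
  Pairing a matrix with a Gram matrix sums its quadratic form over the rows of the factor;
  this is how positive semidefiniteness and singular value bounds enter the trace
  calculations.
\<close>

lemma inner_Gram:
  fixes H :: "real ^ 'm ^ 'n" and N :: "real ^ 'm ^ 'm"
  shows "(transpose H ** H) \<bullet> N = (\<Sum>i\<in>UNIV. H $ i \<bullet> (N *v H $ i))"
proof -
  have "(transpose H ** H) \<bullet> N = H \<bullet> (H ** N)"
    by (simp add: inner_mult_left)
  also have "\<dots> = (H ** transpose N) \<bullet> H"
    by (simp add: inner_mult_right)
  also have "\<dots> = (\<Sum>i\<in>UNIV. H $ i \<bullet> (N *v H $ i))"
  proof -
    have "(H ** transpose N) $ i = N *v H $ i" for i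
      by (vector matrix_matrix_mult_def transpose_def matrix_vector_mult_def mult.commute)
    then show ?thesis
      unfolding inner_vec_def[of "H ** transpose N"] by (simp add: inner_commute)
  qed
  finally show ?thesis .
qed

lemma inner_Gram_eq_norm:
  fixes M :: "real ^ 'm ^ 'n"
  shows "x \<bullet> ((transpose M ** M) *v x) = (norm (M *v x))\<^sup>2"
proof -
  have "x \<bullet> ((transpose M ** M) *v x) = ((M *v x) v* M) \<bullet> x"
    by (simp add: inner_commute flip: matrix_vector_mul_assoc)
  then show ?thesis
    by (simp add: dot_lmul_matrix power2_norm_eq_inner)
qed

lemma matrix_sub_ldistrib:
  fixes A :: "real ^ 'm ^ 'n"
  shows "A ** (B - C) = A ** B - A ** C"
  by (simp add: vec_eq_iff matrix_matrix_mult_def sum_subtractf right_diff_distrib)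

lemma matrix_sub_rdistrib:
  fixes A B :: "real ^ 'm ^ 'n"
  shows "(A - B) ** C = A ** C - B ** C"
  by (simp add: vec_eq_iff matrix_matrix_mult_def sum_subtractf left_diff_distrib)

lemma transpose_diff:
  fixes A B :: "real ^ 'm ^ 'n"
  shows "transpose (A - B) = transpose A - transpose B"
  by (vector transpose_def)

lemma psd_Gram: "psd (R ** transpose R)"
  unfolding psd_def sym_mats_def
  by (auto simp: matrix_transpose_mul dot_lmul_matrix[symmetric] matrix_vector_mul_assoc[symmetric])

lemma inner_Gram_psd_nonneg:
  fixes H :: "real ^ 'm ^ 'n"
  assumes "psd N"
  shows "(transpose H ** H) \<bullet> N \<ge> 0"
  using assms by (simp add: inner_Gram psd_def sum_nonneg)

section \<open>The difference of two Gram matrices\<close>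

text \<open>
  The constant \<open>sqrt 2\<close> in the square is the one for which the remaining term in
  \<open>D \<bullet> D\<close> vanishes.  What is then left of \<open>D = N - G\<close> is linear, and it contributes a
  multiple of \<open>P \<bullet> N\<close>, which has a sign, at the price of lowering the coefficient
  of \<open>P \<bullet> G\<close> from \<open>2\<close> to \<open>2 (sqrt 2 - 1)\<close> (see the proof for \<open>P\<close>, \<open>D\<close>,
  \<open>N\<close> and \<open>G\<close>).
\<close>

lemma factor_difference_lower_bound:
  fixes U V :: "real ^ 'r ^ 'n"
  assumes psd: "psd (transpose U ** V)"
    and s: "\<And>x. s * (norm x)\<^sup>2 \<le> (norm (U *v x))\<^sup>2"
  shows "2 * (sqrt 2 - 1) * s * (norm (V - U))\<^sup>2
           \<le> (norm (V ** transpose V - U ** transpose U))\<^sup>2"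
proof -
  define H where "H = V - U"
  define P where "P = transpose H ** H"
  define G where "G = transpose U ** U"
  define N where "N = transpose U ** V"
  define D where "D = transpose U ** H"
  have N_sym: "transpose N = N"
    using psd by (simp add: psd_def sym_mats_def N_def)
  have G_sym: "transpose G = G"
    by (simp add: G_def matrix_transpose_mul)
  have D_eq: "D = N - G"
    by (simp add: D_def N_def G_def H_def matrix_sub_ldistrib)
  have D_sym: "transpose D = D"
    using N_sym G_sym by (simp add: D_eq transpose_diff)
  have HU: "transpose H ** U = D"
    using D_sym by (simp add: D_def matrix_transpose_mul)
  have split: "V ** transpose V - U ** transpose U =
      (U ** transpose H + H ** transpose U) + H ** transpose H"
    by (simp add: H_def transpose_diff matrix_sub_ldistrib matrix_sub_rdistrib)
  have move: "(A ** transpose B) \<bullet> (C ** transpose E) =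
      (transpose A ** C) \<bullet> (transpose B ** E)" for A B C E :: "real ^ 'r ^ 'n"
  proof -
    have "(A ** transpose B) \<bullet> (C ** transpose E) = transpose B \<bullet> (transpose A ** C ** transpose E)"
      by (simp only: inner_mult_left matrix_mul_assoc)
    also have "\<dots> = (transpose A ** C ** transpose E) \<bullet> transpose B"
      by (rule inner_commute)
    also have "\<dots> = (transpose A ** C) \<bullet> (transpose B ** E)"
      by (simp only: inner_mult_right transpose_transpose)
    finally show ?thesis .
  qed
  have "(norm (V ** transpose V - U ** transpose U))\<^sup>2
      = 2 * (P \<bullet> G) + 2 * (D \<bullet> D) + P \<bullet> P + 4 * (P \<bullet> D)"
    unfolding split power2_norm_eq_inner inner_add_left inner_add_right move HU
      D_def[symmetric] P_def[symmetric] G_def[symmetric]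
    by (simp add: inner_commute)
  also have "\<dots> = (norm (P + sqrt 2 *\<^sub>R D))\<^sup>2 + (4 - 2 * sqrt 2) * (P \<bullet> N)
       + 2 * (sqrt 2 - 1) * (P \<bullet> G)"
    unfolding power2_norm_eq_inner D_eq
    by (simp add: algebra_simps inner_commute)
  finally have eq: "(norm (V ** transpose V - U ** transpose U))\<^sup>2 =
     (norm (P + sqrt 2 *\<^sub>R D))\<^sup>2 + (4 - 2 * sqrt 2) * (P \<bullet> N) + 2 * (sqrt 2 - 1) * (P \<bullet> G)" .
  have PN: "P \<bullet> N \<ge> 0"
    unfolding P_def using psd by (intro inner_Gram_psd_nonneg) (simp add: N_def)
  have sqrt2: "1 \<le> sqrt 2" "sqrt 2 \<le> 2"
    by (auto intro: real_le_lsqrt)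
  have "s * (norm H)\<^sup>2 = (\<Sum>i\<in>UNIV. s * (norm (H $ i))\<^sup>2)"
    by (simp add: power2_norm_eq_inner inner_vec_def[of H H] sum_distrib_left)
  also have "\<dots> \<le> (\<Sum>i\<in>UNIV. (norm (U *v H $ i))\<^sup>2)"
    by (intro sum_mono s)
  also have "\<dots> = P \<bullet> G"
    unfolding P_def G_def inner_Gram inner_Gram_eq_norm ..
  finally have PG: "s * (norm H)\<^sup>2 \<le> P \<bullet> G" .
  have "2 * (sqrt 2 - 1) * (s * (norm H)\<^sup>2) \<le> 2 * (sqrt 2 - 1) * (P \<bullet> G)"
    using PG sqrt2 by (intro mult_left_mono) auto
  moreover have "0 \<le> (4 - 2 * sqrt 2) * (P \<bullet> N)"
    using PN sqrt2 by simp
  moreover have "0 \<le> (norm (P + sqrt 2 *\<^sub>R D))\<^sup>2"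
    by simp
  ultimately show ?thesis
    unfolding eq H_def[symmetric] mult.assoc by linarith
qed

section \<open>Orthogonal alignment of two factors\<close>

text \<open>
  The first-order optimality condition behind both extremal arguments below; \<open>t\<close> is the
  size of a perturbation of an extremal point, and it may have either sign.
\<close>

lemma linear_coeff_zero_if_quadratic_nonneg:
  fixes a b :: real
  assumes "\<And>t. 0 \<le> t\<^sup>2 * a + t * b"
  shows "b = 0"
proof (rule ccontr)
  assume "b \<noteq> 0"
  define c where "c = \<bar>a\<bar> + 1"
  have c: "c > 0" "a < c" by (auto simp: c_def)
  have "(- b / c)\<^sup>2 * a + (- b / c) * b = (b / c)\<^sup>2 * (a - c)"
    using c by (simp add: field_simps power2_eq_square)
  also have "\<dots> < 0"
    using c \<open>b \<noteq> 0\<close> by (intro mult_pos_neg) auto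
  finally show False
    using assms[of "- b / c"] by linarith
qed

text \<open>For \<open>v = 0\<close> the quotient is \<open>0\<close> and the map is the identity.\<close>

definition reflection :: "'a::real_inner \<Rightarrow> 'a \<Rightarrow> 'a" where
  "reflection v x = x - (2 * (v \<bullet> x) / (v \<bullet> v)) *\<^sub>R v"

lemma orthogonal_transformation_reflection: "orthogonal_transformation (reflection v)"
proof -
  have "linear (reflection v)"
    by (rule linearI) (simp_all add: reflection_def algebra_simps add_divide_distrib)
  moreover have "reflection v x \<bullet> reflection v y = x \<bullet> y" for x y
    by (cases "v = 0") (simp_all add: reflection_def inner_diff_left inner_diff_right inner_commute)
  ultimately show ?thesis
    by (simp add: orthogonal_transformation_def)
qed

text \<open>
  Both a single reflection and a product of two reflections differ from the identity by a
  map of rank at most two of this form.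
\<close>

lemma inner_matrix_rank_two_update:
  fixes N :: "real ^ 'm ^ 'm"
  shows "matrix (\<lambda>x. x - (p \<bullet> x) *\<^sub>R q - (u \<bullet> x) *\<^sub>R w) \<bullet> N
           = mat 1 \<bullet> N - q \<bullet> (N *v p) - w \<bullet> (N *v u)"
proof -
  have outer: "(\<Sum>i\<in>UNIV. \<Sum>j\<in>UNIV. a $ i * b $ j * N $ i $ j) = a \<bullet> (N *v b)" for a b :: "real ^ 'm"
    by (simp add: inner_vec_def matrix_vector_mult_def sum_distrib_left mult_ac)
  have entries: "X \<bullet> N = (\<Sum>i\<in>UNIV. \<Sum>j\<in>UNIV. X $ i $ j * N $ i $ j)" for X :: "real ^ 'm ^ 'm"
    by (simp add: inner_vec_def)
  have "matrix (\<lambda>x. x - (p \<bullet> x) *\<^sub>R q - (u \<bullet> x) *\<^sub>R w) $ i $ j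
      = mat 1 $ i $ j - q $ i * p $ j - w $ i * u $ j" for i j
    by (simp add: matrix_def mat_def inner_axis) (simp add: axis_def)
  then have "matrix (\<lambda>x. x - (p \<bullet> x) *\<^sub>R q - (u \<bullet> x) *\<^sub>R w) \<bullet> N
    = mat 1 \<bullet> N - (\<Sum>i\<in>UNIV. \<Sum>j\<in>UNIV. q $ i * p $ j * N $ i $ j)
        - (\<Sum>i\<in>UNIV. \<Sum>j\<in>UNIV. w $ i * u $ j * N $ i $ j)"
    by (simp only: entries left_diff_distrib sum_subtractf)
  then show ?thesis
    by (simp add: outer)
qed

text \<open>
  Testing maximality against the reflection in \<open>v\<close> shows that the quadratic form of \<open>N\<close>
  is nonnegative at \<open>v\<close>.  Symmetry comes from small rotations in coordinate planes: a
  rotation is a product of two reflections, and to first order in the angle it changes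
  the inner product with \<open>N\<close> by a multiple of \<open>N $ i $ j - N $ j $ i\<close>.
\<close>

lemma psd_if_identity_maximizes:
  fixes N :: "real ^ 'm ^ 'm"
  assumes max: "\<And>Q. orthogonal_matrix Q \<Longrightarrow> Q \<bullet> N \<le> mat 1 \<bullet> N"
  shows "psd N"
proof -
  have max': "matrix T \<bullet> N \<le> mat 1 \<bullet> N" if "orthogonal_transformation T" for T
    using max that orthogonal_transformation_matrix by blast
  have nonneg: "0 \<le> v \<bullet> (N *v v)" for v
  proof (cases "v = 0")
    case False
    have "reflection v = (\<lambda>x. x - (v \<bullet> x) *\<^sub>R ((2 / (v \<bullet> v)) *\<^sub>R v) - (0 \<bullet> x) *\<^sub>R 0)"
      by (simp add: reflection_def fun_eq_iff)
    then have "mat 1 \<bullet> N - (2 / (v \<bullet> v)) * (v \<bullet> (N *v v)) \<le> mat 1 \<bullet> N"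
      using max'[OF orthogonal_transformation_reflection[of v]]
      by (simp only: inner_matrix_rank_two_update) simp
    then have "0 \<le> (2 / (v \<bullet> v)) * (v \<bullet> (N *v v))"
      by linarith
    moreover have "0 < 2 / (v \<bullet> v)"
      using False by simp
    ultimately show ?thesis
      by (metis linorder_not_le mult_pos_neg)
  qed simp
  have sym: "N $ i $ j = N $ j $ i" for i j
  proof (cases "i = j")
    case False
    define a b where "a = N $ i $ i + N $ j $ j" and "b = N $ j $ i - N $ i $ j"
    have key: "0 \<le> t\<^sup>2 * a + t * b" for t
    proof -
      \<comment> \<open>The reflections in \<open>u\<close> and \<open>v\<close> compose to a rotation of the \<open>i\<close>-\<open>j\<close> plane by an angle
        of size \<open>2 arctan t\<close>; this parametrization keeps everything rational in \<open>t\<close>.\<close>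
      define u where "u = (axis i 1 :: real ^ 'm)"
      define v where "v = u + t *\<^sub>R axis j 1"
      have uu: "u \<bullet> u = 1" and uv: "u \<bullet> v = 1" "v \<bullet> u = 1" and vv: "v \<bullet> v = 1 + t\<^sup>2"
        using False by (simp_all add: u_def v_def inner_axis_axis algebra_simps power2_eq_square)
      have v_pos: "0 < v \<bullet> v"
        unfolding vv by (simp add: add_pos_nonneg)
      have Nu: "u \<bullet> (N *v u) = N $ i $ i"
        and Nvu: "u \<bullet> (N *v v) = N $ i $ i + t * N $ i $ j"
        and Nvv: "v \<bullet> (N *v v) = N $ i $ i + t * (N $ i $ j + N $ j $ i) + t\<^sup>2 * N $ j $ j"
        by (simp_all add: u_def v_def inner_axis inner_axis' algebra_simps matrix_vector_right_distrib
            matrix_vector_mult_scaleR matrix_vector_mult_basis column_def power2_eq_square)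
      have "reflection u \<circ> reflection v = (\<lambda>x. x - (v \<bullet> x) *\<^sub>R ((2 / (v \<bullet> v)) *\<^sub>R (v - 2 *\<^sub>R u))
               - (u \<bullet> x) *\<^sub>R (2 *\<^sub>R u))"
        using uu uv by (simp add: reflection_def fun_eq_iff algebra_simps)
      then have "mat 1 \<bullet> N - ((2 / (v \<bullet> v)) *\<^sub>R (v - 2 *\<^sub>R u)) \<bullet> (N *v v) - (2 *\<^sub>R u) \<bullet> (N *v u) \<le> mat 1 \<bullet> N"
        using max'[OF orthogonal_transformation_compose
           [OF orthogonal_transformation_reflection[of u] orthogonal_transformation_reflection[of v]]]
        by (simp only: inner_matrix_rank_two_update)
      then have "0 \<le> 2 / (v \<bullet> v) * (v \<bullet> (N *v v) - 2 * (u \<bullet> (N *v v))) + 2 * (u \<bullet> (N *v u))"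
        by (simp only: inner_diff_left inner_scaleR_left)
      also have "\<dots> = (2 / (v \<bullet> v)) * (v \<bullet> (N *v v) - 2 * (u \<bullet> (N *v v)) + (v \<bullet> v) * (u \<bullet> (N *v u)))"
        using v_pos by (simp add: field_simps)
      finally have "0 \<le> v \<bullet> (N *v v) - 2 * (u \<bullet> (N *v v)) + (v \<bullet> v) * (u \<bullet> (N *v u))"
        using v_pos by (metis divide_pos_pos linorder_not_le mult_pos_neg zero_less_numeral)
      then show ?thesis
        unfolding Nu Nvu Nvv vv a_def b_def by (simp add: algebra_simps)
    qed
    show ?thesis
      using linear_coeff_zero_if_quadratic_nonneg[OF key] by (simp add: b_def)
  qed simp
  show ?thesis
    unfolding psd_def sym_mats_def using nonneg sym by (auto simp: transpose_def vec_eq_iff)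
qed


lemma compact_orthogonal_matrices: "compact {Q :: real ^ 'm ^ 'm. orthogonal_matrix Q}"
proof -
  have "continuous_on UNIV (\<lambda>Q :: real ^ 'm ^ 'm. transpose Q ** Q)"
    unfolding matrix_matrix_mult_def transpose_def by (intro continuous_intros)
  then have "closed {Q :: real ^ 'm ^ 'm. transpose Q ** Q = mat 1}"
    by (intro closed_Collect_eq continuous_on_const)
  moreover have "norm Q = norm (mat 1 :: real ^ 'm ^ 'm)" if "orthogonal_matrix Q" for Q :: "real ^ 'm ^ 'm"
  proof -
    have "Q \<bullet> Q = mat 1 \<bullet> (mat 1 :: real ^ 'm ^ 'm)"
      using that by (simp add: inner_matrix_eq_trace orthogonal_matrix_def)
    then show ?thesis by (simp add: norm_eq_sqrt_inner)
  qed
  then have "bounded {Q :: real ^ 'm ^ 'm. orthogonal_matrix Q}"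
    by (intro boundedI[of _ "norm (mat 1 :: real ^ 'm ^ 'm)"]) auto
  ultimately show ?thesis
    by (simp add: compact_eq_bounded_closed orthogonal_matrix)
qed

text \<open>
  \<open>Q\<close> maximizes the inner product of \<open>U Q\<close> with \<open>V\<close>; replacing \<open>Q\<close> by \<open>Q W\<close> with \<open>W\<close>
  orthogonal does not increase it, so that the identity is the best choice of \<open>W\<close>.
\<close>

lemma exists_orthogonal_alignment:
  fixes U V :: "real ^ 'r ^ 'n"
  obtains Q where "orthogonal_matrix Q" "psd (transpose (U ** Q) ** V)"
proof -
  have "continuous_on {Q. orthogonal_matrix Q} (\<lambda>Q. Q \<bullet> (transpose U ** V))"
    by (intro continuous_intros)
  moreover have "{Q :: real ^ 'r ^ 'r. orthogonal_matrix Q} \<noteq> {}"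
    using orthogonal_matrix_id by blast
  ultimately obtain Q where Q: "orthogonal_matrix Q"
    and max: "\<And>Q'. orthogonal_matrix Q' \<Longrightarrow> Q' \<bullet> (transpose U ** V) \<le> Q \<bullet> (transpose U ** V)"
    using continuous_attains_sup[OF compact_orthogonal_matrices] by (metis (mono_tags, lifting) mem_Collect_eq)
  have "psd (transpose (U ** Q) ** V)"
  proof (rule psd_if_identity_maximizes)
    fix W :: "real ^ 'r ^ 'r"
    assume "orthogonal_matrix W"
    then have "(Q ** W) \<bullet> (transpose U ** V) \<le> Q \<bullet> (transpose U ** V)"
      using Q max orthogonal_matrix_mul by blast
    then have "(Q ** W) \<bullet> (transpose U ** V) \<le> (Q ** mat 1) \<bullet> (transpose U ** V)"
      by simp
    then show "W \<bullet> (transpose (U ** Q) ** V) \<le> mat 1 \<bullet> (transpose (U ** Q) ** V)"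
      unfolding inner_mult_left by (simp add: matrix_transpose_mul matrix_mul_assoc)
  qed
  with Q that show thesis by blast
qed

section \<open>Eigenspaces of symmetric matrices\<close>

lemma sym_mats_inner_commute:
  assumes "B \<in> sym_mats"
  shows "x \<bullet> (B *v y) = (B *v x) \<bullet> y"
  using assms by (metis (mono_tags, lifting) dot_lmul_matrix mem_Collect_eq sym_mats_def transpose_matrix_vector)

text \<open>
  The quadratic form attains its minimum \<open>\<mu>\<close> over the unit sphere of \<open>W\<close> at some \<open>v\<close>.
  Moving \<open>v\<close> slightly against the residual \<open>B v - \<mu> v\<close>, which stays in \<open>W\<close> by
  invariance, would decrease the Rayleigh quotient below \<open>\<mu>\<close> unless the residual is zero.
\<close>

lemma Rayleigh_minimizer_eigenvector:
  fixes B :: "real ^ 'm ^ 'm"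
  assumes B: "B \<in> sym_mats"
    and W: "subspace W" and inv: "\<And>x. x \<in> W \<Longrightarrow> B *v x \<in> W"
    and w: "w \<in> W" "w \<noteq> 0"
  obtains v \<mu> where "v \<in> W" "v \<noteq> 0" "v \<in> eigenspace B \<mu>"
    "\<And>x. x \<in> W \<Longrightarrow> \<mu> * (x \<bullet> x) \<le> x \<bullet> (B *v x)"
proof -
  have "compact (W \<inter> sphere 0 1)"
    using closed_subspace[OF W] by (intro closed_Int_compact) auto
  moreover have "(1 / norm w) *\<^sub>R w \<in> W \<inter> sphere 0 1"
    using w W by (simp add: subspace_scale)
  then have "W \<inter> sphere 0 1 \<noteq> {}" by blast
  moreover have "continuous_on (W \<inter> sphere 0 1) (\<lambda>x. x \<bullet> (B *v x))"
    by (intro continuous_intros)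
  ultimately obtain v where v: "v \<in> W" "norm v = 1"
    and vmin: "\<And>x. x \<in> W \<Longrightarrow> norm x = 1 \<Longrightarrow> v \<bullet> (B *v v) \<le> x \<bullet> (B *v x)"
    using continuous_attains_inf[of "W \<inter> sphere 0 1" "\<lambda>x. x \<bullet> (B *v x)"]
    by (metis (no_types, lifting) IntE IntI mem_sphere_0)
  define \<mu> where "\<mu> = v \<bullet> (B *v v)"
  have le: "\<mu> * (x \<bullet> x) \<le> x \<bullet> (B *v x)" if "x \<in> W" for x
  proof (cases "x = 0")
    case False
    let ?y = "(1 / norm x) *\<^sub>R x"
    have "\<mu> \<le> ?y \<bullet> (B *v ?y)"
      unfolding \<mu>_def using that W False by (intro vmin) (auto simp: subspace_scale)
    also have "\<dots> = (x \<bullet> (B *v x)) / (x \<bullet> x)"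
      by (simp add: matrix_vector_mult_scaleR dot_square_norm power2_eq_square)
    finally show ?thesis
      using False by (simp add: field_simps)
  qed simp
  define w where "w = B *v v - \<mu> *\<^sub>R v"
  have "w \<in> W"
    unfolding w_def using W v inv by (simp add: subspace_diff subspace_scale)
  have vv: "v \<bullet> v = 1"
    using v by (simp add: dot_square_norm)
  have "0 \<le> t\<^sup>2 * (w \<bullet> (B *v w) - \<mu> * (w \<bullet> w)) + t * (2 * (w \<bullet> w))" for t
  proof -
    have "v + t *\<^sub>R w \<in> W"
      using v \<open>w \<in> W\<close> W by (simp add: subspace_add subspace_scale)
    from le[OF this]
    have "0 \<le> t\<^sup>2 * (w \<bullet> (B *v w) - \<mu> * (w \<bullet> w)) + t * (w \<bullet> (B *v v) + v \<bullet> (B *v w) - 2 * \<mu> * (v \<bullet> w))"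
      by (simp add: matrix_vector_right_distrib matrix_vector_mult_scaleR inner_add_left inner_add_right
          power2_eq_square algebra_simps vv inner_commute \<mu>_def)
    moreover have "w \<bullet> (B *v v) + v \<bullet> (B *v w) - 2 * \<mu> * (v \<bullet> w) = 2 * (w \<bullet> w)"
      by (subst sym_mats_inner_commute[OF B, of v w])
        (simp add: w_def inner_diff_left inner_diff_right inner_commute algebra_simps)
    ultimately show ?thesis by simp
  qed
  from linear_coeff_zero_if_quadratic_nonneg[OF this] have "w = 0" by simp
  then have "v \<in> eigenspace B \<mu>" by (simp add: eigenspace_def w_def)
  moreover have "v \<noteq> 0" using v by auto
  ultimately show thesis using that v le by blast
qed

definition eigenvalues :: "real ^ 'm ^ 'm \<Rightarrow> real set" where
  "eigenvalues B = {\<mu>. \<exists>v. v \<noteq> 0 \<and> v \<in> eigenspace B \<mu>}"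

lemma eigenspaces_orthogonal:
  assumes "B \<in> sym_mats" "x \<in> eigenspace B \<mu>" "y \<in> eigenspace B \<nu>" "\<mu> \<noteq> \<nu>"
  shows "x \<bullet> y = 0"
proof -
  have "\<nu> * (x \<bullet> y) = \<mu> * (x \<bullet> y)"
    using sym_mats_inner_commute[OF assms(1), of x y] assms(2,3) by (simp add: eigenspace_def)
  with assms(4) show ?thesis by simp
qed

lemma dim_Union_eigenspaces:
  assumes B: "B \<in> sym_mats" and "finite F"
  shows "dim (\<Union>\<mu>\<in>F. eigenspace B \<mu>) = (\<Sum>\<mu>\<in>F. dim (eigenspace B \<mu>))"
  using \<open>finite F\<close>
proof (induction F)
  case (insert \<mu> F)
  have "dim (eigenspace B \<mu> \<union> (\<Union>\<nu>\<in>F. eigenspace B \<nu>))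
      = dim (eigenspace B \<mu>) + dim (\<Union>\<nu>\<in>F. eigenspace B \<nu>)"
    using insert.hyps eigenspaces_orthogonal[OF B] by (intro dim_orthogonal_sum) blast
  then show ?case using insert by simp
qed simp

lemma finite_eigenvalues:
  fixes B :: "real ^ 'm ^ 'm"
  assumes B: "B \<in> sym_mats"
  shows "finite (eigenvalues B)"
proof -
  have "card F \<le> CARD('m)" if F: "F \<subseteq> eigenvalues B" "finite F" for F
  proof -
    have "1 \<le> dim (eigenspace B \<mu>)" if "\<mu> \<in> F" for \<mu>
      using F that by (auto simp: eigenvalues_def Suc_le_eq zero_less_iff_neq_zero)
    then have "card F \<le> (\<Sum>\<mu>\<in>F. dim (eigenspace B \<mu>))"
      using sum_mono[of F "\<lambda>_. 1::nat"] by simp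
    also have "\<dots> \<le> CARD('m)"
      using dim_subset_UNIV_cart dim_Union_eigenspaces[OF B F(2)] by metis
    finally show ?thesis .
  qed
  then show ?thesis using finite_if_finite_subsets_card_bdd by blast
qed

text \<open>
  The spectral theorem, as a count of dimensions: the orthogonal complement of all
  eigenspaces is invariant, so if it were nonzero, it would contain an eigenvector, which
  would be orthogonal to itself.
\<close>

lemma sum_dim_eigenspaces:
  fixes B :: "real ^ 'm ^ 'm"
  assumes B: "B \<in> sym_mats"
  shows "(\<Sum>\<mu>\<in>eigenvalues B. dim (eigenspace B \<mu>)) = CARD('m)"
proof -
  define S where "S = (\<Union>\<mu>\<in>eigenvalues B. eigenspace B \<mu>)"
  define W where "W = {x. \<forall>y\<in>S. orthogonal x y}"
  have "dim S = CARD('m)"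
  proof (rule ccontr)
    assume "dim S \<noteq> CARD('m)"
    then have "dim S < DIM(real ^ 'm)"
      using dim_subset_UNIV[of S] by simp
    then obtain w where w: "w \<noteq> 0" and "\<And>y. y \<in> span S \<Longrightarrow> orthogonal w y"
      by (rule orthogonal_to_subspace_exists) blast
    then have "w \<in> W"
      by (simp add: W_def span_base)
    have "subspace W"
      by (auto simp: W_def subspace_def orthogonal_def inner_add_left)
    moreover have "B *v x \<in> W" if "x \<in> W" for x
    proof -
      have "orthogonal (B *v x) y" if y: "y \<in> S" for y
      proof -
        obtain \<mu> where "B *v y = \<mu> *\<^sub>R y"
          using y by (auto simp: S_def eigenspace_def)
        moreover have "x \<bullet> y = 0"
          using \<open>x \<in> W\<close> y by (simp add: W_def orthogonal_def)
        ultimately show ?thesis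
          using sym_mats_inner_commute[OF B, of x y] by (simp add: orthogonal_def)
      qed
      then show ?thesis by (simp add: W_def)
    qed
    ultimately obtain v \<mu> where v: "v \<in> W" "v \<noteq> 0" "v \<in> eigenspace B \<mu>"
      using Rayleigh_minimizer_eigenvector[OF B _ _ \<open>w \<in> W\<close> w] by metis
    then have "v \<in> S" by (auto simp: S_def eigenvalues_def)
    with v show False by (auto simp: W_def orthogonal_def)
  qed
  then show ?thesis
    using dim_Union_eigenspaces[OF B finite_eigenvalues[OF B]] by (simp add: S_def)
qed

section \<open>The least singular value\<close>

lemma
  fixes M :: "real ^ 'm ^ 'n"
  shows size_singular_values: "size (singular_values M) = CARD('m)"
    and set_mset_singular_values: "set_mset (singular_values M) = sqrt ` eigenvalues (transpose M ** M)"
proof -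
  define B where "B = transpose M ** M"
  have B: "B \<in> sym_mats"
    by (simp add: B_def sym_mats_def matrix_transpose_mul)
  have sv: "singular_values M = (\<Sum>\<mu>\<in>eigenvalues B. replicate_mset (dim (eigenspace B \<mu>)) (sqrt \<mu>))"
    by (simp add: singular_values_def eigenvalues_def B_def)
  show "size (singular_values M) = CARD('m)"
    unfolding sv by (simp add: size_multiset_sum sum_dim_eigenspaces[OF B])
  have "0 < dim (eigenspace B \<mu>)" if "\<mu> \<in> eigenvalues B" for \<mu>
    using that by (auto simp: eigenvalues_def zero_less_iff_neq_zero)
  then show "set_mset (singular_values M) = sqrt ` eigenvalues (transpose M ** M)"
    unfolding sv B_def[symmetric]
    by (auto simp: set_mset_sum finite_eigenvalues[OF B] simp del: dim_eq_0)
qed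

text \<open>
  There are as many singular values as columns, so the last index of the decreasing list
  selects the minimum; its square is at most the least eigenvalue of \<open>M\<^sup>T M\<close>, which is
  the minimum of the Rayleigh quotient.
\<close>

lemma sing_val_last_le:
  fixes M :: "real ^ 'm ^ 'n"
  shows "(sing_val CARD('m) M)\<^sup>2 * (norm x)\<^sup>2 \<le> (norm (M *v x))\<^sup>2"
proof -
  define B where "B = transpose M ** M"
  define L where "L = sorted_list_of_multiset (singular_values M)"
  have B: "B \<in> sym_mats"
    by (simp add: B_def sym_mats_def matrix_transpose_mul)
  have quad: "y \<bullet> (B *v y) = (norm (M *v y))\<^sup>2" for y
    unfolding B_def by (rule inner_Gram_eq_norm)
  have len: "length L = CARD('m)"
    by (metis L_def mset_sorted_list_of_multiset size_mset size_singular_values)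
  have set_L: "set L = sqrt ` eigenvalues B"
    by (metis L_def B_def set_mset_singular_values set_mset_mset mset_sorted_list_of_multiset)
  have sv: "sing_val CARD('m) M = L ! 0"
    using len by (simp add: sing_val_def L_def[symmetric] rev_nth)
  have eig_nonneg: "0 \<le> \<mu>" if "\<mu> \<in> eigenvalues B" for \<mu>
  proof -
    obtain v where v: "v \<noteq> 0" "B *v v = \<mu> *\<^sub>R v"
      using \<open>\<mu> \<in> eigenvalues B\<close> by (auto simp: eigenvalues_def eigenspace_def)
    then have "0 \<le> \<mu> * (v \<bullet> v)"
      using quad[of v] by simp
    then show ?thesis
      using v by (metis inner_gt_zero_iff linorder_not_le mult_neg_pos)
  qed
  obtain v \<mu> where v: "v \<noteq> 0" "v \<in> eigenspace B \<mu>" and \<mu>: "\<mu> * (x \<bullet> x) \<le> x \<bullet> (B *v x)"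
    using Rayleigh_minimizer_eigenvector[OF B subspace_UNIV, of "axis undefined 1"]
    by (metis UNIV_I axis_eq_0_iff zero_neq_one)
  have \<mu>_eig: "\<mu> \<in> eigenvalues B"
    using v by (auto simp: eigenvalues_def)
  have "L ! 0 \<in> set L"
    using len by (intro nth_mem) simp
  then have "0 \<le> L ! 0"
    using set_L eig_nonneg by auto
  moreover have "L ! 0 \<le> sqrt \<mu>"
  proof -
    have "sqrt \<mu> \<in> set L"
      using set_L \<mu>_eig by blast
    then obtain k where "k < length L" "L ! k = sqrt \<mu>"
      by (metis in_set_conv_nth)
    then show ?thesis
      using sorted_nth_mono[of L 0 k] by (simp add: L_def sorted_sorted_list_of_multiset)
  qed
  ultimately have "(L ! 0)\<^sup>2 \<le> \<mu>"
    using power_mono[of "L ! 0" "sqrt \<mu>" 2] eig_nonneg[OF \<mu>_eig] by simp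
  then have "(L ! 0)\<^sup>2 * (norm x)\<^sup>2 \<le> \<mu> * (x \<bullet> x)"
    by (simp add: dot_square_norm mult_right_mono)
  with \<mu> show ?thesis
    by (simp add: sv quad)
qed

section \<open>Distance to the set of factors\<close>

text \<open>
  The aligned factor \<open>U = R\<^sub>0 Q\<close> is one factor of \<open>R\<^sub>0 R\<^sub>0\<^sup>T\<close> and has the same singular value
  bound as \<open>R\<^sub>0\<close>; its distance from \<open>R\<close> bounds the distance to the set from above.
\<close>

lemma sing_val_infdist_sol_set_le:
  fixes R R\<^sub>0 :: "real ^ 'r ^ 'n"
  shows "2 * (sqrt 2 - 1) * (sing_val CARD('r) R\<^sub>0)\<^sup>2 * (infdist R (sol_set (R\<^sub>0 ** transpose R\<^sub>0)))\<^sup>2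
           \<le> (norm (R ** transpose R - R\<^sub>0 ** transpose R\<^sub>0))\<^sup>2"
proof -
  obtain Q where Q: "orthogonal_matrix Q" and psd: "psd (transpose (R\<^sub>0 ** Q) ** R)"
    using exists_orthogonal_alignment by blast
  define U where "U = R\<^sub>0 ** Q"
  define s where "s = (sing_val CARD('r) R\<^sub>0)\<^sup>2"
  have UU: "U ** transpose U = R\<^sub>0 ** transpose R\<^sub>0"
    using Q by (metis U_def matrix_mul_assoc matrix_mul_rid matrix_transpose_mul orthogonal_matrix_def)
  have "s * (norm x)\<^sup>2 \<le> (norm (U *v x))\<^sup>2" for x
  proof -
    have "norm (Q *v x) = norm x"
      using Q by (metis matrix_of_matrix_vector_mul matrix_vector_mul_linear orthogonal_transformation_matrix
          orthogonal_transformation_norm)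
    then show ?thesis
      using sing_val_last_le[of R\<^sub>0 "Q *v x"] by (simp add: U_def s_def matrix_vector_mul_assoc)
  qed
  then have bound: "2 * (sqrt 2 - 1) * s * (norm (R - U))\<^sup>2 \<le> (norm (R ** transpose R - U ** transpose U))\<^sup>2"
    using psd by (intro factor_difference_lower_bound) (simp_all add: U_def)
  have "infdist R (sol_set (R\<^sub>0 ** transpose R\<^sub>0)) \<le> norm (R - U)"
    using UU infdist_le[of U "sol_set (R\<^sub>0 ** transpose R\<^sub>0)" R] by (simp add: sol_set_def dist_norm)
  then have "(infdist R (sol_set (R\<^sub>0 ** transpose R\<^sub>0)))\<^sup>2 \<le> (norm (R - U))\<^sup>2"
    by (intro power_mono infdist_nonneg)
  then have "2 * (sqrt 2 - 1) * s * (infdist R (sol_set (R\<^sub>0 ** transpose R\<^sub>0)))\<^sup>2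
      \<le> 2 * (sqrt 2 - 1) * s * (norm (R - U))\<^sup>2"
    by (intro mult_left_mono) (auto simp: s_def)
  also note bound
  finally show ?thesis by (simp only: UU s_def)
qed

theorem lemma4:
  fixes f :: "real ^ 'n ^ 'n \<Rightarrow> real"
    and A :: "'k::finite \<Rightarrow> real ^ 'n ^ 'n"
    and b :: "real ^ 'k"
    and Xs :: "real ^ 'n ^ 'n"
    and Rs :: "real ^ 'r ^ 'n"
    and \<alpha>f \<epsilon> :: real
  assumes f_smooth: "smooth_on_sym f"
    and f_convex: "convex_on sym_mats f"
    and A_sym: "\<And>i. A i \<in> sym_mats"
    and Xs_eq: "Xs = Rs ** transpose Rs"
    and Rs_rank: "rank Rs = CARD('r)"
    and Xs_min: "unique_minimizer f (\<lambda>X. lin_meas A X = b \<and> psd X) Xs"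
    and \<alpha>f_pos: "\<alpha>f > 0"
    and \<epsilon>_pos: "\<epsilon> > 0"
    and growth: "\<And>X. psd X \<Longrightarrow> lin_meas A X = b \<Longrightarrow> rank X \<le> CARD('r) \<Longrightarrow> norm (X - Xs) \<le> \<epsilon> \<Longrightarrow>
                   f X \<ge> f Xs + \<alpha>f / 2 * (norm (X - Xs))\<^sup>2"
  shows "\<forall>R :: real ^ 'r ^ 'n.
           lin_meas A (R ** transpose R) = b \<and> norm (R ** transpose R - Xs) \<le> \<epsilon> \<longrightarrow>
           factor_obj f R \<ge> factor_obj f Rs
             + (2 * (sqrt 2 - 1) * (sing_val CARD('r) Rs)\<^sup>2 * \<alpha>f) / 2
               * (infdist R (sol_set Xs))\<^sup>2"
proof (intro allI impI, elim conjE)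
  fix R :: "real ^ 'r ^ 'n"
  assume meas: "lin_meas A (R ** transpose R) = b" and near: "norm (R ** transpose R - Xs) \<le> \<epsilon>"
  have "rank (R ** transpose R) \<le> CARD('r)"
    using rank_mul_le_left[of R "transpose R"] rank_bound[of R] by linarith
  with meas near have "f Xs + \<alpha>f / 2 * (norm (R ** transpose R - Xs))\<^sup>2 \<le> f (R ** transpose R)"
    by (intro growth psd_Gram)
  moreover have "\<alpha>f / 2 * (2 * (sqrt 2 - 1) * (sing_val CARD('r) Rs)\<^sup>2 * (infdist R (sol_set Xs))\<^sup>2)
      \<le> \<alpha>f / 2 * (norm (R ** transpose R - Xs))\<^sup>2"
    using \<alpha>f_pos sing_val_infdist_sol_set_le[of Rs R] unfolding Xs_eq
    by (intro mult_left_mono) auto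
  ultimately show "factor_obj f R \<ge> factor_obj f Rs
      + (2 * (sqrt 2 - 1) * (sing_val CARD('r) Rs)\<^sup>2 * \<alpha>f) / 2 * (infdist R (sol_set Xs))\<^sup>2"
    unfolding factor_obj_def Xs_eq[symmetric] by (simp add: mult_ac)
qed

end
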